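(* Let $a=\{a(n)\}_{n\in\mathbb{Z}}$ be a sequence of real numbers. Then for every $m\in\mathbb{Z}$, $$M' a(m)\ \le\ M a(m)\ \le\ 3\,M' a(m),$$ where $M'$ is the centered and $M$ the non-centered Hardy-Littlewood maximal operator.
   Context: An interval in $\mathbb{Z}$ is a finite nonempty set of consecutive integers, and $|I|$ denotes its cardinality. For a real sequence $a=\{a(n)\}_{n\in\mathbb{Z}}$ and $m\in\mathbb{Z}$ define, with values in $[0,\infty]$: Centered Hardy-Littlewood maximal operator: $M'a(m)=\sup_{r\ge 1}\frac{1}{2r+1}\sum_{n=-r}^{r}|a(m-n)|$, the supremum being over positive integers $r$. Hardy-Littlewood maximal operator: $Ma(m)=\sup_{I\ni m}\frac{1}{|I|}\sum_{n\in I}|a(n)|$, the supremum being over all intervals $I$ in $\mathbb{Z}$ containing $m$. *)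

theory Defs
  imports "HOL-Analysis.Analysis"
begin

definition int_interval :: "int set \<Rightarrow> bool" where
  "int_interval I \<longleftrightarrow> (\<exists>k l. k \<le> l \<and> I = {k..l})"

text \<open>The averages below are finite nonnegative reals; only the suprema are taken in
  \<^typ>\<open>ennreal\<close>, so that they exist without any boundedness assumption on \<open>a\<close>.\<close>

definition centered_maximal :: "(int \<Rightarrow> real) \<Rightarrow> int \<Rightarrow> ennreal" where
  "centered_maximal a m =
     (SUP r\<in>{r::nat. r \<ge> 1}.
        ennreal (1 / (2 * real r + 1) * (\<Sum>n = - int r..int r. \<bar>a (m - n)\<bar>)))"

definition maximal :: "(int \<Rightarrow> real) \<Rightarrow> int \<Rightarrow> ennreal" where
  "maximal a m =
     (SUP I\<in>{I. int_interval I \<and> m \<in> I}.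
        ennreal (1 / real (card I) * (\<Sum>n\<in>I. \<bar>a n\<bar>)))"

end

theory Submission
  imports Defs
begin

text \<open>A centered average is an average over an interval containing \<open>m\<close>, which gives the first
  inequality. Conversely, an interval \<open>I\<close> of \<open>N\<close> points containing \<open>m\<close> lies in the
  centered interval of radius \<open>N\<close>, whose length \<open>2 N + 1\<close> is at most \<open>3 N\<close>.\<close>

text \<open>The reflection \<open>n \<mapsto> m - n\<close> is its own inverse and exchanges the two
  ranges. This turns the convolution form of a centered average into a sum over an interval around
  \<open>m\<close>.\<close>

lemma sum_centered_eq:
  fixes f :: "int \<Rightarrow> 'a::comm_monoid_add"
  shows "(\<Sum>n = - r..r. f (m - n)) = (\<Sum>n = m - r..m + r. f n)"
  by (rule sum.reindex_bij_witness[of _ "\<lambda>n. m - n" "\<lambda>n. m - n"]) auto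

lemma centered_maximal_le_maximal: "centered_maximal a m \<le> maximal a m"
  unfolding centered_maximal_def
proof (rule SUP_least)
  fix r :: nat
  let ?I = "{m - int r..m + int r}"
  have "int_interval ?I \<and> m \<in> ?I"
    unfolding int_interval_def by auto
  moreover have "real (card ?I) = 2 * real r + 1"
    by simp
  \<comment> \<open>After reflection the centered average is exactly the term that \<open>?I\<close>
    contributes to the supremum.\<close>
  ultimately show "ennreal (1 / (2 * real r + 1) * (\<Sum>n = - int r..int r. \<bar>a (m - n)\<bar>)) \<le> maximal a m"
    unfolding maximal_def sum_centered_eq[of "\<lambda>n. \<bar>a n\<bar>"]
    by (intro SUP_upper2[of ?I]) auto
qed

text \<open>Radius \<open>N - 1\<close> would already cover \<open>I\<close>, but it is 0 for a
  singleton, whereas \<open>centered_maximal\<close> admits only radii at least 1.\<close>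

lemma interval_average_le:
  assumes "int_interval I" "m \<in> I"
  defines "N \<equiv> card I"
  shows "1 / real N * (\<Sum>n\<in>I. \<bar>a n\<bar>)
    \<le> 3 * (1 / (2 * real N + 1) * (\<Sum>n = - int N..int N. \<bar>a (m - n)\<bar>))"
proof -
  obtain k l where I: "I = {k..l}" "k \<le> l"
    using assms(1) unfolding int_interval_def by auto
  have N: "int N = l - k + 1" "N \<ge> 1"
    using I by (auto simp: N_def)
  \<comment> \<open>Points of \<open>I\<close> differ from \<open>m\<close> by at most
    \<open>N - 1\<close>, and the added terms are nonnegative.\<close>
  have "(\<Sum>n\<in>I. \<bar>a n\<bar>) \<le> (\<Sum>n = m - int N..m + int N. \<bar>a n\<bar>)"
    using assms(2) N(1) I(1) by (intro sum_mono2) auto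
  \<comment> \<open>Cross-multiplied, this is \<open>2 * N + 1 \<le> 3 * N\<close>, that is
    \<open>N \<ge> 1\<close>.\<close>
  moreover have "1 / real N \<le> 3 * (1 / (2 * real N + 1))"
    using N(2) by (simp add: field_simps)
  ultimately have "1 / real N * (\<Sum>n\<in>I. \<bar>a n\<bar>)
      \<le> 3 * (1 / (2 * real N + 1)) * (\<Sum>n = m - int N..m + int N. \<bar>a n\<bar>)"
    by (intro mult_mono) (auto intro: sum_nonneg)
  then show ?thesis
    unfolding sum_centered_eq[of "\<lambda>n. \<bar>a n\<bar>"] by (simp only: mult.assoc)
qed

lemma maximal_le_centered_maximal: "maximal a m \<le> 3 * centered_maximal a m"
  unfolding maximal_def
proof (rule SUP_least)
  fix I assume "I \<in> {I. int_interval I \<and> m \<in> I}"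
  then have I: "int_interval I" "m \<in> I" by auto
  define N where "N = card I"
  define c where "c = 1 / (2 * real N + 1) * (\<Sum>n = - int N..int N. \<bar>a (m - n)\<bar>)"
  \<comment> \<open>Thus \<open>N\<close> is an admissible radius and \<open>c\<close> is one of the
    averages in the centered supremum.\<close>
  have "N \<ge> 1"
    using I(1) unfolding N_def int_interval_def by auto
  then have "ennreal c \<le> centered_maximal a m"
    unfolding centered_maximal_def c_def by (intro SUP_upper) auto
  moreover have "ennreal (1 / real (card I) * (\<Sum>n\<in>I. \<bar>a n\<bar>)) \<le> ennreal (3 * c)"
    using interval_average_le[OF I] unfolding c_def N_def by (rule ennreal_leI)
  moreover have "ennreal (3 * c) = 3 * ennreal c"
    by (simp add: ennreal_mult')
  ultimately show "ennreal (1 / real (card I) * (\<Sum>n\<in>I. \<bar>a n\<bar>)) \<le> 3 * centered_maximal a m"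
    by (metis mult_left_mono order_trans zero_le)
qed

theorem theorem4p1:
  fixes a :: "int \<Rightarrow> real" and m :: int
  shows "centered_maximal a m \<le> maximal a m \<and> maximal a m \<le> 3 * centered_maximal a m"
  using centered_maximal_le_maximal maximal_le_centered_maximal by blast

end
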